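(* Suppose that $\Phi_R\in C^2(\mathbb R^{n_x};\mathbb R_+)$ is $\mu$-strongly convex, i.e. $\Phi_R(x_1)-\Phi_R(x_2)\ge\langle\nabla\Phi_R(x_2),x_1-x_2\rangle+\frac{\mu}{2}\|x_1-x_2\|^2$ for some $\mu>0$ and all $x_1,x_2\in\mathbb R^{n_x}$, and $L$-smooth, i.e. $\Phi_R(x_1)-\Phi_R(x_2)\le\langle\nabla\Phi_R(x_2),x_1-x_2\rangle+\frac{L}{2}\|x_1-x_2\|^2$ for some $L>0$ and all $x_1,x_2\in\mathbb R^{n_x}$ (and therefore satisfies the PL-inequality $\nu'\|\nabla\Phi_R(x)\|^2\ge\Phi_R(x)-\Phi_R(\hat x)$, $x\in\mathbb R^{n_x}$, for some $\nu'>0$, where $\hat x$ is a stationary point, i.e. $\nabla\Phi_R(\hat x)=0$). Let $x_\ast$ be the unique global minimizer of the equality constrained problem $$\min_{x\in\mathbb R^{n_x}}\Phi_R(x)\quad\text{s.t.}\quad h_i(x)=\langle q^{(i)},x\rangle=0,\quad i=J+1,\dots,n_x.$$ Then there exists $\nu>0$ such that for all $x\in\mathcal B$ it holds true that $$\nu\|\nabla\Phi_R(x)\|^2\ge\Phi_R(x)-\Phi_R(x_\ast).$$ Moreover, let $\mathcal P_{\mathcal B}$ be the orthogonal projection onto $\mathcal B$. Then it holds true that $$\nu\|\mathcal P_{\mathcal B}\nabla\Phi_R(\mathcal P_{\mathcal B}x)\|^2\ge\Phi_R(\mathcal P_{\mathcal B}x)-\Phi_R(x_\ast)$$ for all $x\in\mathbb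 R^{n_x}$.
   Context: Let $n_x,K,J\in\mathbb N$ with $J\ge2$, let $y\in\mathbb R^K$ be fixed, let $G:\mathbb R^{n_x}\to\mathbb R^K$, and let $\Gamma\in\mathbb R^{K\times K}$, $C_0\in\mathbb R^{n_x\times n_x}$ be symmetric positive definite. $\|\cdot\|$ is the Euclidean norm, and $\Phi_R(x)=\frac12\|\Gamma^{-1/2}(G(x)-y)\|^2+\frac12\|C_0^{-1/2}x\|^2$. Let $(u_0^{(j)})_{j=1,\dots,J}$ be a linearly independent initial ensemble in $\mathbb R^{n_x}$ with mean $\bar u_0=\frac1J\sum_ju_0^{(j)}$ and put $e_0^{(j)}=u_0^{(j)}-\bar u_0$. Let $\mathcal B=u_0^\perp+\operatorname{span}\{e_0^{(j)}\mid j=1,\dots,J\}$, where $u_0^\perp=\bar u_0-\mathcal P_E\bar u_0$ and $\mathcal P_E$ is the orthogonal projection onto $\operatorname{span}\{e_0^{(j)}\mid j=1,\dots,J\}$. The vectors $q^{(i)}\in\mathbb R^{n_x}$, $i=J+1,\dots,n_x$, satisfy $q^{(i)}\perp e_0^{(j)}$ and $q^{(i)}\perp u_0^\perp$ for all $j=1,\dots,J$ and $i=J+1,\dots,n_x$; the equality constrained problem is introduced as a reformulation of minimizing $\Phi_R$ over $\mathcal B$. *)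

theory Defs
  imports "HOL-Analysis.Analysis"
begin

definition sym_pos_def :: "real ^ 'n ^ 'n \<Rightarrow> bool" where
  "sym_pos_def A \<longleftrightarrow> transpose A = A \<and> (\<forall>x. x \<noteq> 0 \<longrightarrow> x \<bullet> (A *v x) > 0)"

(* The principal square root: a symmetric positive definite matrix has exactly one
   symmetric positive definite square root.  For other matrices the value is unspecified. *)
definition spd_sqrt :: "real ^ 'n ^ 'n \<Rightarrow> real ^ 'n ^ 'n" where
  "spd_sqrt A = (THE S. sym_pos_def S \<and> S ** S = A)"

definition spd_inv_sqrt :: "real ^ 'n ^ 'n \<Rightarrow> real ^ 'n ^ 'n" where
  "spd_inv_sqrt A = matrix_inv (spd_sqrt A)"

definition Phi_R ::
  "(real ^ 'n \<Rightarrow> real ^ 'k) \<Rightarrow> real ^ 'k \<Rightarrow> real ^ 'k ^ 'k \<Rightarrow> real ^ 'n ^ 'n \<Rightarrow> real ^ 'n \<Rightarrow> real"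
  where
  "Phi_R G y \<Gamma> C0 x =
     1/2 * (norm (spd_inv_sqrt \<Gamma> *v (G x - y)))\<^sup>2 + 1/2 * (norm (spd_inv_sqrt C0 *v x))\<^sup>2"


(* Unspecified at points where f is not differentiable. *)
definition gradient :: "('a::real_inner \<Rightarrow> real) \<Rightarrow> 'a \<Rightarrow> 'a" where
  "gradient f x = (THE D. GDERIV f x :> D)"

lemma gradient_eqI:
  assumes "GDERIV f x :> D"
  shows "gradient f x = D"
  unfolding gradient_def
proof (rule the_equality)
  fix D' assume "GDERIV f x :> D'"
  with assms have "(\<lambda>h. h \<bullet> D') = (\<lambda>h. h \<bullet> D)"
    unfolding gderiv_def using has_derivative_unique by blast
  then have "(D' - D) \<bullet> (D' - D) = 0"
    by (metis inner_diff_right right_minus_eq)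
  then show "D' = D" by simp
qed (fact assms)

(* f is differentiable, and its gradient has a continuous derivative H (the Hessian). *)
definition C2_fun :: "(real ^ 'n \<Rightarrow> real) \<Rightarrow> bool" where
  "C2_fun f \<longleftrightarrow>
     (\<forall>x. GDERIV f x :> gradient f x) \<and>
     (\<exists>H :: real ^ 'n \<Rightarrow> real ^ 'n ^ 'n.
        (\<forall>x. (gradient f has_derivative (\<lambda>h. H x *v h)) (at x)) \<and> continuous_on UNIV H)"

definition strongly_convex :: "real \<Rightarrow> ('a::real_inner \<Rightarrow> real) \<Rightarrow> bool" where
  "strongly_convex \<mu> f \<longleftrightarrow>
     (\<forall>x1 x2. f x1 - f x2 \<ge> gradient f x2 \<bullet> (x1 - x2) + \<mu> / 2 * (norm (x1 - x2))\<^sup>2)"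

definition L_smooth :: "real \<Rightarrow> ('a::real_inner \<Rightarrow> real) \<Rightarrow> bool" where
  "L_smooth L f \<longleftrightarrow>
     (\<forall>x1 x2. f x1 - f x2 \<le> gradient f x2 \<bullet> (x1 - x2) + L / 2 * (norm (x1 - x2))\<^sup>2)"


(* Orthogonal projection onto a nonempty closed affine subspace S (in particular, onto a
   linear subspace): the foot p of the perpendicular from x, i.e. x - p is orthogonal to
   every direction a - p of S. *)
definition orth_proj :: "'a::real_inner set \<Rightarrow> 'a \<Rightarrow> 'a" where
  "orth_proj S x = (THE p. p \<in> S \<and> (\<forall>a\<in>S. (x - p) \<bullet> (a - p) = 0))"

lemma orth_proj_ex1:
  fixes S :: "'a::euclidean_space set"
  assumes "affine S" "S \<noteq> {}"
  shows "\<exists>!p. p \<in> S \<and> (\<forall>a\<in>S. (x - p) \<bullet> (a - p) = 0)"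
proof -
  obtain c where c: "c \<in> S" using assms by blast
  define V where "V = (\<lambda>a. a - c) ` S"
  have V: "subspace V"
    unfolding V_def using affine_diffs_subspace_subtract[OF assms(1) c] by simp
  obtain v w where v: "v \<in> span V" and w: "\<And>z. z \<in> span V \<Longrightarrow> orthogonal w z"
    and x: "x - c = v + w"
    using orthogonal_subspace_decomp_exists[of V "x - c"] by metis
  have spV: "span V = V" using V by (simp add: span_eq_iff)
  have S: "a \<in> S \<longleftrightarrow> a - c \<in> V" for a unfolding V_def by auto
  show ?thesis
  proof (rule ex1I[of _ "c + v"])
    have "(x - (c + v)) \<bullet> (a - (c + v)) = 0" if "a \<in> S" for a
    proof -
      have "(a - c) - v \<in> V" using that S V v spV subspace_diff by metis
      then have "w \<bullet> ((a - c) - v) = 0" using w spV by (auto simp: orthogonal_def)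
      moreover have "x - (c + v) = w" using x by (simp add: algebra_simps)
      ultimately show ?thesis by (simp add: diff_diff_eq)
    qed
    then show "c + v \<in> S \<and> (\<forall>a\<in>S. (x - (c + v)) \<bullet> (a - (c + v)) = 0)"
      using S v spV by simp
    fix p assume p: "p \<in> S \<and> (\<forall>a\<in>S. (x - p) \<bullet> (a - p) = 0)"
    let ?q = "c + v"
    have q: "?q \<in> S" using S v spV by simp
    have 1: "(x - p) \<bullet> (?q - p) = 0" using p q by blast
    have 2: "(x - ?q) \<bullet> (p - ?q) = 0"
      using \<open>\<And>a. a \<in> S \<Longrightarrow> (x - ?q) \<bullet> (a - ?q) = 0\<close> p by blast
    have "(?q - p) \<bullet> (?q - p) = (x - p) \<bullet> (?q - p) + (x - ?q) \<bullet> (p - ?q)"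
      by (simp add: inner_diff_left inner_diff_right inner_add_left inner_add_right inner_commute)
    then show "p = ?q" using 1 2 by simp
  qed
qed


(* Ensembles of size J are families indexed by 1, ..., J; values at other indices are ignored. *)

definition ens_mean :: "nat \<Rightarrow> (nat \<Rightarrow> 'a::real_vector) \<Rightarrow> 'a" where
  "ens_mean J u = (1 / real J) *\<^sub>R (\<Sum>j = 1..J. u j)"

definition ens_dev :: "nat \<Rightarrow> (nat \<Rightarrow> 'a::real_vector) \<Rightarrow> nat \<Rightarrow> 'a" where
  "ens_dev J u j = u j - ens_mean J u"

definition ens_span :: "nat \<Rightarrow> (nat \<Rightarrow> 'a::real_vector) \<Rightarrow> 'a set" where
  "ens_span J u = span (ens_dev J u ` {1..J})"

definition ens_perp :: "nat \<Rightarrow> (nat \<Rightarrow> 'a::real_inner) \<Rightarrow> 'a" where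
  "ens_perp J u = ens_mean J u - orth_proj (ens_span J u) (ens_mean J u)"

definition ens_affine :: "nat \<Rightarrow> (nat \<Rightarrow> 'a::real_inner) \<Rightarrow> 'a set" where
  "ens_affine J u = (\<lambda>v. ens_perp J u + v) ` ens_span J u"

definition feasible :: "nat \<Rightarrow> (nat \<Rightarrow> real ^ 'n) \<Rightarrow> real ^ 'n \<Rightarrow> bool" where
  "feasible J q x \<longleftrightarrow> (\<forall>i\<in>{J+1..CARD('n)}. q i \<bullet> x = 0)"

end

theory Submission
  imports Defs
begin

text \<open>
  Write \<open>E\<close> for the span of the deviations and \<open>u\<close> for \<open>ens_perp J u0\<close>, so that \<open>B = u + E\<close>.
  Minimizing the quadratic lower bound of strong convexity over the displacement gives
  \<open>\<Phi> x - \<Phi> z \<le> 1/(2\<mu>) * (norm p)\<^sup>2\<close> whenever \<open>p\<close> and \<open>gradient \<Phi> x\<close> have the same inner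
  product with \<open>z - x\<close> (\<open>strongly_convex_gap\<close>).  With \<open>p = gradient \<Phi> x\<close> this is the
  PL inequality on the whole space, relative to any comparison point \<open>z\<close>.  The minimizers exist
  because a strongly convex function is coercive (\<open>strongly_convex_ex1_arg_min\<close>).

  For the projected inequality, note that \<open>orth_proj B\<close> is an affine projection.  If \<open>g\<close> is a
  gradient at a point of \<open>B\<close>, then \<open>orth_proj B g = u + v\<close>, where \<open>v\<close> is the projection of
  \<open>g\<close> onto \<open>E\<close>, and \<open>(norm (orth_proj B g))\<^sup>2 = (norm u)\<^sup>2 + (norm v)\<^sup>2\<close>.  The term in \<open>v\<close> bounds
  \<open>\<Phi> x - \<Phi> u\<close> for \<open>x \<in> B\<close>, again by \<open>strongly_convex_gap\<close>.  The remaining gap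
  \<open>\<Phi> u - \<Phi> xs\<close> does not depend on \<open>x\<close>, so for large \<open>\<nu>\<close> it is absorbed by the term in \<open>u\<close>,
  because linear independence of the ensemble forces \<open>u \<noteq> 0\<close> (\<open>ens_perp_nonzero\<close>).
\<close>

lemma strongly_convexD:
  assumes "strongly_convex \<mu> f"
  shows "f x - f z \<ge> gradient f z \<bullet> (x - z) + \<mu> / 2 * (norm (x - z))\<^sup>2"
  using assms unfolding strongly_convex_def by blast

text \<open>Allowing any \<open>p\<close> that agrees with the gradient in the direction \<open>z - x\<close> covers both the
  full gradient and its projection onto a subspace containing \<open>z - x\<close>.\<close>

lemma strongly_convex_gap:
  fixes f :: "'a::real_inner \<Rightarrow> real"
  assumes f: "strongly_convex \<mu> f" and "\<mu> > 0"
    and p: "p \<bullet> (z - x) = gradient f x \<bullet> (z - x)"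
  shows "f x - f z \<le> 1 / (2 * \<mu>) * (norm p)\<^sup>2"
proof -
  \<comment> \<open>Complete the square in \<open>d = z - x\<close>.\<close>
  define d where "d = z - x"
  have "0 \<le> (norm (p + \<mu> *\<^sub>R d))\<^sup>2 / (2 * \<mu>)"
    using \<open>\<mu> > 0\<close> by simp
  also have "(norm (p + \<mu> *\<^sub>R d))\<^sup>2 = (norm p)\<^sup>2 + 2 * \<mu> * (p \<bullet> d) + \<mu>\<^sup>2 * (norm d)\<^sup>2"
    unfolding power2_norm_eq_inner
    by (simp add: inner_add_left inner_add_right inner_commute power2_eq_square algebra_simps)
  also have "\<dots> / (2 * \<mu>) = 1 / (2 * \<mu>) * (norm p)\<^sup>2 + (p \<bullet> d + \<mu> / 2 * (norm d)\<^sup>2)"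
    using \<open>\<mu> > 0\<close> by (simp add: field_simps power2_eq_square)
  finally show ?thesis
    using strongly_convexD[OF f, of x z] p by (simp add: d_def)
qed

lemma strongly_convex_ex1_arg_min:
  fixes f :: "'a::euclidean_space \<Rightarrow> real"
  assumes f: "strongly_convex \<mu> f" and "\<mu> > 0" and cont: "continuous_on UNIV f"
    and S: "closed S" "convex S" "S \<noteq> {}"
  shows "\<exists>!x. is_arg_min f (\<lambda>x. x \<in> S) x"
proof -
  obtain a where a: "a \<in> S" using S by blast
  define C where "C = S \<inter> {x. f x \<le> f a}"
  \<comment> \<open>Sublevel sets are bounded: dividing the lower bound at \<open>a\<close> by \<open>norm (x - a)\<close> leaves
    \<open>\<mu> / 2 * norm (x - a) \<le> norm (gradient f a)\<close>.\<close>
  have "C \<subseteq> cball a (2 * norm (gradient f a) / \<mu>)"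
  proof
    fix x assume "x \<in> C"
    then have "gradient f a \<bullet> (x - a) + \<mu> / 2 * (norm (x - a))\<^sup>2 \<le> 0"
      using strongly_convexD[OF f, of a x] unfolding C_def by simp
    moreover have "- (norm (gradient f a) * norm (x - a)) \<le> gradient f a \<bullet> (x - a)"
      using Cauchy_Schwarz_ineq2[of "gradient f a" "x - a"] by linarith
    ultimately have "norm (x - a) * (\<mu> / 2 * norm (x - a)) \<le> norm (x - a) * norm (gradient f a)"
      by (simp add: power2_eq_square algebra_simps)
    then have "\<mu> / 2 * norm (x - a) \<le> norm (gradient f a)"
      by (cases "norm (x - a) = 0") (auto simp: mult_le_cancel_left)
    then show "x \<in> cball a (2 * norm (gradient f a) / \<mu>)"
      using \<open>\<mu> > 0\<close> by (simp add: dist_norm norm_minus_commute field_simps)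
  qed
  then have "bounded C"
    using bounded_cball bounded_subset by blast
  moreover have "closed C"
    unfolding C_def using S cont by (intro closed_Int closed_Collect_le) auto
  ultimately have "compact C"
    by (simp add: compact_eq_bounded_closed)
  moreover have "a \<in> C"
    using a by (simp add: C_def)
  ultimately obtain m where m: "m \<in> C" "\<forall>x\<in>C. f m \<le> f x"
    using continuous_attains_inf[of C f] continuous_on_subset[OF cont] by blast
  then have "f m \<le> f x" if "x \<in> S" for x
    using that unfolding C_def by force
  then have "is_arg_min f (\<lambda>x. x \<in> S) m"
    using m unfolding is_arg_min_linorder C_def by blast
  moreover have "x = z"
    if "is_arg_min f (\<lambda>x. x \<in> S) x" "is_arg_min f (\<lambda>x. x \<in> S) z" for x z
  proof -
    \<comment> \<open>The lower bounds at the midpoint of two minimizers have opposite linear terms.\<close>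
    define h where "h = (1/2) *\<^sub>R (x - z)"
    define w where "w = (1/2) *\<^sub>R x + (1/2) *\<^sub>R z"
    have x: "x - w = h" and z: "z - w = - h"
      unfolding h_def w_def by (simp_all add: algebra_simps scaleR_left_distrib[symmetric])
    have "w \<in> S"
      using that S unfolding w_def is_arg_min_linorder by (auto intro: convexD)
    then have "f x \<le> f w" "f z \<le> f w"
      using that unfolding is_arg_min_linorder by auto
    moreover have "f x - f w \<ge> gradient f w \<bullet> h + \<mu> / 2 * (norm h)\<^sup>2"
      using strongly_convexD[OF f, of w x] x by simp
    moreover have "f z - f w \<ge> - (gradient f w \<bullet> h) + \<mu> / 2 * (norm h)\<^sup>2"
      using strongly_convexD[OF f, of w z] z by simp
    ultimately have "\<mu> * (norm h)\<^sup>2 \<le> 0" by linarith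
    then have "h = 0"
      using \<open>\<mu> > 0\<close> by (simp add: mult_le_0_iff)
    then show "x = z" by (simp add: h_def)
  qed
  ultimately show ?thesis by blast
qed

lemma gradient_zero_at_global_min:
  fixes f :: "'a::real_inner \<Rightarrow> real"
  assumes D: "GDERIV f x :> D" and min: "\<And>z. f x \<le> f z"
  shows "D = 0"
proof -
  have "(\<lambda>h. h \<bullet> D) = (\<lambda>h. 0)"
    using differential_zero_maxmin[of x UNIV f "\<lambda>h. h \<bullet> D"] D min
    unfolding gderiv_def by auto
  then have "D \<bullet> D = 0" by metis
  then show ?thesis by simp
qed

lemma orth_proj_props:
  fixes S :: "'a::euclidean_space set"
  assumes "affine S" "S \<noteq> {}"
  shows "orth_proj S x \<in> S" and "a \<in> S \<Longrightarrow> (x - orth_proj S x) \<bullet> (a - orth_proj S x) = 0"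
  using theI'[OF orth_proj_ex1[OF assms, of x]] unfolding orth_proj_def by auto

lemma subspace_ens_span: "subspace (ens_span J u)"
  by (simp add: ens_span_def)

lemma ens_perp_orthogonal:
  fixes u :: "nat \<Rightarrow> 'a::euclidean_space"
  assumes "v \<in> ens_span J u"
  shows "ens_perp J u \<bullet> v = 0"
proof -
  let ?p = "orth_proj (ens_span J u) (ens_mean J u)"
  have aff: "affine (ens_span J u)" "ens_span J u \<noteq> {}"
    using subspace_ens_span subspace_imp_affine subspace_0 by blast+
  have "v + ?p \<in> ens_span J u"
    using assms orth_proj_props(1)[OF aff] subspace_add[OF subspace_ens_span] by blast
  then show ?thesis
    using orth_proj_props(2)[OF aff, of "v + ?p" "ens_mean J u"] by (simp add: ens_perp_def)
qed

text \<open>The linear functional equal to 1 on the whole ensemble is 1 at the mean but vanishes on the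
  deviations, so the mean does not lie in their span.\<close>

lemma ens_perp_nonzero:
  fixes u :: "nat \<Rightarrow> 'a::euclidean_space"
  assumes "J > 0" and "independent (u ` {1..J})"
  shows "ens_perp J u \<noteq> 0"
proof
  assume "ens_perp J u = 0"
  moreover have "orth_proj (ens_span J u) (ens_mean J u) \<in> ens_span J u"
    using subspace_ens_span subspace_imp_affine subspace_0 by (intro orth_proj_props(1)) blast+
  ultimately have mem: "ens_mean J u \<in> ens_span J u"
    by (simp add: ens_perp_def)
  obtain f :: "'a \<Rightarrow> real" where "linear f" and f: "\<forall>x\<in>u ` {1..J}. f x = 1"
    using linear_independent_extend[OF assms(2), of "\<lambda>_. 1 :: real"] by auto
  have "f (ens_mean J u) = (1 / real J) * (\<Sum>j = 1..J. f (u j))"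
    by (simp add: ens_mean_def linear_scale[OF \<open>linear f\<close>] linear_sum[OF \<open>linear f\<close>])
  then have mean: "f (ens_mean J u) = 1"
    using f \<open>J > 0\<close> by simp
  then have "f x = 0" if "x \<in> ens_dev J u ` {1..J}" for x
    using that f by (auto simp: ens_dev_def linear_diff[OF \<open>linear f\<close>])
  then have "f (ens_mean J u) = 0"
    using linear_eq_0_on_span[OF \<open>linear f\<close>] mem unfolding ens_span_def by blast
  then show False using mean by simp
qed

lemma ens_affine_diff:
  assumes "x \<in> ens_affine J u" "z \<in> ens_affine J u"
  shows "x - z \<in> ens_span J u"
  using assms subspace_diff[OF subspace_ens_span] unfolding ens_affine_def by fastforce

lemma affine_ens_affine: "affine (ens_affine J u)"
  unfolding ens_affine_def
  by (simp add: affine_translation[symmetric] subspace_imp_affine subspace_ens_span)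

lemma ens_perp_mem_ens_affine: "ens_perp J u \<in> ens_affine J u"
  using subspace_0[OF subspace_ens_span] unfolding ens_affine_def by force

lemma orth_proj_ens_affine:
  fixes u :: "nat \<Rightarrow> 'a::euclidean_space"
  obtains v where "(norm (orth_proj (ens_affine J u) g))\<^sup>2 = (norm (ens_perp J u))\<^sup>2 + (norm v)\<^sup>2"
    and "\<And>d. d \<in> ens_span J u \<Longrightarrow> v \<bullet> d = g \<bullet> d"
proof -
  let ?p = "orth_proj (ens_affine J u) g"
  have ne: "ens_affine J u \<noteq> {}" using ens_perp_mem_ens_affine by blast
  note proj = orth_proj_props[OF affine_ens_affine ne]
  from proj(1)[of g] obtain v where v: "v \<in> ens_span J u" and p: "?p = ens_perp J u + v"
    unfolding ens_affine_def by auto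
  have "(norm ?p)\<^sup>2 = (norm (ens_perp J u))\<^sup>2 + (norm v)\<^sup>2"
    unfolding p using ens_perp_orthogonal[OF v]
    by (simp add: power2_norm_eq_inner inner_add_left inner_add_right inner_commute)
  moreover have "v \<bullet> d = g \<bullet> d" if d: "d \<in> ens_span J u" for d
  proof -
    have "?p + d \<in> ens_affine J u"
      unfolding p using subspace_add[OF subspace_ens_span v d]
      by (auto simp: ens_affine_def add.assoc)
    then have "(g - ?p) \<bullet> d = 0"
      using proj(2)[of "?p + d" g] by simp
    then show ?thesis
      using ens_perp_orthogonal[OF d] by (simp add: p inner_diff_left inner_add_left)
  qed
  ultimately show thesis using that by blast
qed

lemma subspace_feasible: "subspace {x. feasible J q x}"
  unfolding feasible_def subspace_def by (simp add: inner_add_right)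

theorem lemma4p6:
  fixes G :: "real ^ 'n \<Rightarrow> real ^ 'k" and y :: "real ^ 'k"
    and \<Gamma> :: "real ^ 'k ^ 'k" and C0 :: "real ^ 'n ^ 'n"
    and J :: nat and u0 :: "nat \<Rightarrow> real ^ 'n" and q :: "nat \<Rightarrow> real ^ 'n"
    and \<mu> L :: real
  defines "\<Phi> \<equiv> Phi_R G y \<Gamma> C0"
    and "B \<equiv> ens_affine J u0"
  assumes "sym_pos_def \<Gamma>" and "sym_pos_def C0"
    and "J \<ge> 2"
    and "inj_on u0 {1..J}" and "independent (u0 ` {1..J})"
    and "\<And>i j. i \<in> {J+1..CARD('n)} \<Longrightarrow> j \<in> {1..J} \<Longrightarrow> orthogonal (q i) (ens_dev J u0 j)"
    and "\<And>i. i \<in> {J+1..CARD('n)} \<Longrightarrow> orthogonal (q i) (ens_perp J u0)"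
    and "C2_fun \<Phi>"
    and "\<mu> > 0" and "strongly_convex \<mu> \<Phi>"
    and "L > 0" and "L_smooth L \<Phi>"
  shows "((\<exists>xh. gradient \<Phi> xh = 0) \<and>
          (\<exists>\<nu>'>0. \<forall>xh. gradient \<Phi> xh = 0 \<longrightarrow>
             (\<forall>x. \<nu>' * (norm (gradient \<Phi> x))\<^sup>2 \<ge> \<Phi> x - \<Phi> xh))) \<and>
         (\<exists>!xs. is_arg_min \<Phi> (feasible J q) xs) \<and>
         (\<forall>xs. is_arg_min \<Phi> (feasible J q) xs \<longrightarrow>
            (\<exists>\<nu>>0.
               (\<forall>x\<in>B. \<nu> * (norm (gradient \<Phi> x))\<^sup>2 \<ge> \<Phi> x - \<Phi> xs) \<and>
               (\<forall>x. \<nu> * (norm (orth_proj B (gradient \<Phi> (orth_proj B x))))\<^sup>2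
                      \<ge> \<Phi> (orth_proj B x) - \<Phi> xs)))"
proof (intro conjI allI impI)
  note sc = \<open>strongly_convex \<mu> \<Phi>\<close> and pos = \<open>\<mu> > 0\<close>
  have grad: "GDERIV \<Phi> x :> gradient \<Phi> x" for x
    using \<open>C2_fun \<Phi>\<close> unfolding C2_fun_def by blast
  have cont: "continuous_on UNIV \<Phi>"
    using grad unfolding gderiv_def
    by (auto intro!: continuous_at_imp_continuous_on has_derivative_continuous)
  have PL: "1 / (2 * \<mu>) * (norm (gradient \<Phi> x))\<^sup>2 \<ge> \<Phi> x - \<Phi> z" for x z
    by (rule strongly_convex_gap[OF sc pos]) simp
  show "\<exists>xh. gradient \<Phi> xh = 0"
  proof -
    obtain xh where "is_arg_min \<Phi> (\<lambda>x. x \<in> UNIV) xh"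
      using strongly_convex_ex1_arg_min[OF sc pos cont, of UNIV] by auto
    then show ?thesis
      using gradient_zero_at_global_min[OF grad] unfolding is_arg_min_linorder by blast
  qed
  show "\<exists>\<nu>'>0. \<forall>xh. gradient \<Phi> xh = 0 \<longrightarrow>
      (\<forall>x. \<nu>' * (norm (gradient \<Phi> x))\<^sup>2 \<ge> \<Phi> x - \<Phi> xh)"
    using PL pos by (intro exI[of _ "1 / (2 * \<mu>)"]) simp
  show "\<exists>!xs. is_arg_min \<Phi> (feasible J q) xs"
    using strongly_convex_ex1_arg_min[OF sc pos cont, of "{x. feasible J q x}"]
      subspace_feasible[of J q] closed_subspace subspace_imp_convex subspace_0 by fastforce
  fix xs assume "is_arg_min \<Phi> (feasible J q) xs"
  let ?u = "ens_perp J u0"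
  have u: "norm ?u > 0"
    using ens_perp_nonzero[of J u0] \<open>J \<ge> 2\<close> \<open>independent (u0 ` {1..J})\<close> by simp
  define c where "c = \<bar>\<Phi> ?u - \<Phi> xs\<bar> / (norm ?u)\<^sup>2"
  define \<nu> where "\<nu> = 1 / (2 * \<mu>) + c"
  have "c \<ge> 0" by (simp add: c_def)
  then have "\<nu> > 0" and le: "1 / (2 * \<mu>) \<le> \<nu>" and "c \<le> \<nu>"
    using pos by (simp_all add: \<nu>_def add_pos_nonneg)
  have "\<nu> * (norm (gradient \<Phi> x))\<^sup>2 \<ge> \<Phi> x - \<Phi> xs" for x
    using PL[of x xs] mult_right_mono[OF le, of "(norm (gradient \<Phi> x))\<^sup>2"] by simp
  moreover have "\<nu> * (norm (orth_proj B (gradient \<Phi> (orth_proj B x))))\<^sup>2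
      \<ge> \<Phi> (orth_proj B x) - \<Phi> xs" for x
  proof -
    define z where "z = orth_proj B x"
    have "z \<in> B"
      unfolding z_def B_def
      using ens_perp_mem_ens_affine by (intro orth_proj_props(1) affine_ens_affine) blast
    then have d: "?u - z \<in> ens_span J u0"
      unfolding B_def by (intro ens_affine_diff ens_perp_mem_ens_affine)
    obtain v where nv: "(norm (orth_proj B (gradient \<Phi> z)))\<^sup>2 = (norm ?u)\<^sup>2 + (norm v)\<^sup>2"
      and v: "\<And>d. d \<in> ens_span J u0 \<Longrightarrow> v \<bullet> d = gradient \<Phi> z \<bullet> d"
      unfolding B_def using orth_proj_ens_affine by blast
    have "\<Phi> z - \<Phi> ?u \<le> 1 / (2 * \<mu>) * (norm v)\<^sup>2"
      by (rule strongly_convex_gap[OF sc pos v[OF d]])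
    also have "\<dots> \<le> \<nu> * (norm v)\<^sup>2"
      by (rule mult_right_mono[OF le]) simp
    finally have "\<Phi> z - \<Phi> ?u \<le> \<nu> * (norm v)\<^sup>2" .
    moreover have "\<Phi> ?u - \<Phi> xs \<le> \<nu> * (norm ?u)\<^sup>2"
    proof -
      have "\<Phi> ?u - \<Phi> xs \<le> c * (norm ?u)\<^sup>2"
        using u by (simp add: c_def)
      also have "\<dots> \<le> \<nu> * (norm ?u)\<^sup>2"
        by (rule mult_right_mono[OF \<open>c \<le> \<nu>\<close>]) simp
      finally show ?thesis .
    qed
    ultimately show ?thesis
      unfolding z_def[symmetric] nv by (simp add: distrib_left)
  qed
  ultimately show "\<exists>\<nu>>0. (\<forall>x\<in>B. \<nu> * (norm (gradient \<Phi> x))\<^sup>2 \<ge> \<Phi> x - \<Phi> xs) \<and>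
      (\<forall>x. \<nu> * (norm (orth_proj B (gradient \<Phi> (orth_proj B x))))\<^sup>2 \<ge> \<Phi> (orth_proj B x) - \<Phi> xs)"
    using \<open>\<nu> > 0\<close> by blast
qed

end
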